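(* Let $f$ be an entire function of order $\rho$ with $0<\rho<\frac12$. Then there exists a sequence of positive numbers $R_1<R_2<\dots$ with $R_j\to\infty$ such that for every $k\in\mathbb{Z}^+$, $$\lim_{j\to\infty}\sum_{|\phi_{0n}(w)|<R_j}\phi_{0n}^{(k)}(w)=0\qquad\text{for all }w\in\mathbb{C};$$ equivalently, $\lim_{j\to\infty}\frac{d^k}{dw^k}\Big\{\sum_{|\phi_{0n}(w)|<R_j}\phi_{0n}(w)\Big\}=0$ for all $w\in\mathbb{C}$.
   Context: ${\rm Aut}(f)=\{\phi_{0n}\}_n$ denotes the automorphic functions of $f$: branches $\phi$ of $f^{-1}\circ f$, i.e. analytic solutions of $f(\phi(w))=f(w)$. For fixed $w$, the values $\{\phi_{0n}(w)\}_n$ are the zeros of $u\mapsto f(u)-f(w)$ listed with multiplicity, and $\phi_{0n}^{(k)}(w)$ is the $k$-th derivative at $w$ of the corresponding branch. *)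

theory Defs
  imports "HOL-Complex_Analysis.Complex_Analysis" "HOL-Library.Liminf_Limsup"
begin

definition max_modulus :: "(complex \<Rightarrow> complex) \<Rightarrow> real \<Rightarrow> real" where
  "max_modulus f r = (SUP z\<in>sphere 0 r. norm (f z))"

definition entire_order :: "(complex \<Rightarrow> complex) \<Rightarrow> ereal" where
  "entire_order f = Limsup at_top (\<lambda>r::real. ereal (ln (ln (max_modulus f r)) / ln r))"

text \<open>Sum of the values phi_0n(w) of the automorphic functions with |phi_0n(w)| < R,
  i.e. the sum of the zeros u of (u -> f u - f w) in the open disc of radius R,
  counted with multiplicity.\<close>
definition aut_sum :: "(complex \<Rightarrow> complex) \<Rightarrow> real \<Rightarrow> complex \<Rightarrow> complex" where
  "aut_sum f R w =
     (\<Sum>u\<in>{u. norm u < R \<and> f u = f w}. of_int (zorder (\<lambda>v. f v - f w) u) * u)"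

end

theory Submission
  imports Defs "HOL-Real_Asymp.Real_Asymp"
begin

text \<open>For large \<open>R\<close> the sum over \<open>|\<phi>(w)| < R\<close> is the residue integral of
  \<open>u f'(u) / (f(u) - f(w))\<close> over \<open>|u| = R\<close>. Integrating by parts, its value at \<open>w\<close> minus its value
  at \<open>0\<close> is an integral of \<open>log ((f(u) - f(w)) / (f(u) - f(0)))\<close>, which is \<open>O(R / min |f|)\<close>. So it
  suffices to find circles \<open>|u| = R\<^sub>j\<close> on which \<open>|f| / R\<^sub>j\<close> tends to infinity; the derivatives are
  then controlled by Cauchy's estimates.

  Such circles exist because the order is below \<open>1/2\<close> (Wiman). Up to an additive constant, \<open>f\<close> is a
  genus zero product \<open>\<Prod>(1 - z / a\<^sub>i)\<close>, and on \<open>|z| = r\<close> it dominates \<open>G(r)\<close> in modulus, where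
  \<open>G(z) = \<Prod>(1 - z / |a\<^sub>i|)\<close>. If the minimum modulus of \<open>f\<close> were \<open>O(r)\<close>, then \<open>G\<close> without its first
  factor would be bounded on the positive axis; having order below \<open>1/2\<close>, it would be constant by
  Phragmen-Lindelof in the slit plane, although it has zeros.\<close>

section \<open>Borel-Caratheodory and Phragmen-Lindelof\<close>

text \<open>The conclusion bounds a logarithm of \<open>h z\<close>, so it forces \<open>h z\<close>
  towards 1 once \<open>A\<close> is small compared with \<open>R\<close>. A holomorphic logarithm
  exists because \<open>h\<close> has no zeros in the disc; its real part stays below
  \<open>A\<close>, and the Schwarz lemma turns this into a bound on its modulus.\<close>

lemma borel_caratheodory_exp:
  fixes h :: "complex \<Rightarrow> complex"
  assumes hol: "h holomorphic_on ball 0 R" and h0: "h 0 = 1"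
    and nz: "\<And>z. z \<in> ball 0 R \<Longrightarrow> h z \<noteq> 0"
    and bd: "\<And>z. z \<in> ball 0 R \<Longrightarrow> norm (h z) < exp A"
    and A: "A > 0" and zR: "norm z < R"
  obtains L where "h z = exp L" "norm L \<le> 2 * A * norm z / (R - norm z)"
proof -
  have R: "R > 0" using zR norm_ge_zero[of z] by linarith
  obtain \<phi>' where \<phi>': "\<phi>' holomorphic_on ball 0 R" "\<And>z. z \<in> ball 0 R \<Longrightarrow> h z = exp (\<phi>' z)"
    using contractible_imp_holomorphic_log[OF hol convex_imp_contractible[OF convex_ball] nz] by metis
  define \<phi> where "\<phi> = (\<lambda>z. \<phi>' z - \<phi>' 0)"
  have \<phi>: "\<phi> holomorphic_on ball 0 R" unfolding \<phi>_def by (intro holomorphic_intros \<phi>')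
  have \<phi>0: "\<phi> 0 = 0" by (simp add: \<phi>_def)
  have e: "h z = exp (\<phi> z)" if "z \<in> ball 0 R" for z
    using \<phi>'(2)[OF that] \<phi>'(2)[of 0] h0 R by (simp add: \<phi>_def exp_diff)
  have Re: "Re (\<phi> z) < A" if "z \<in> ball 0 R" for z
    using bd[OF that] e[OF that] by simp
  \<comment> \<open>The Moebius map taking \<open>w\<close> to \<open>w / (2 * A - w)\<close> fixes
    0 and sends the half-plane \<open>Re w < A\<close> into the unit disc, because such
    \<open>w\<close> lie closer to 0 than to \<open>2 * A\<close>.\<close>
  define \<psi> where "\<psi> = (\<lambda>\<zeta>::complex. \<phi> (R * \<zeta>) / (2 * A - \<phi> (R * \<zeta>)))"
  have inb: "of_real R * \<zeta> \<in> ball 0 R" if "norm \<zeta> < 1" for \<zeta> :: complex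
    using that R by (simp add: norm_mult)
  have den: "2 * complex_of_real A - \<phi> (R * \<zeta>) \<noteq> 0" if "norm \<zeta> < 1" for \<zeta> :: complex
  proof
    assume "2 * complex_of_real A - \<phi> (R * \<zeta>) = 0"
    then have "Re (2 * complex_of_real A - \<phi> (R * \<zeta>)) = 0" by simp
    then show False using Re[OF inb[OF that]] A by simp
  qed
  have \<psi>hol: "\<psi> holomorphic_on ball 0 1"
  proof -
    have "(\<phi> \<circ> (\<lambda>\<zeta>. of_real R * \<zeta>)) holomorphic_on ball 0 1"
      by (rule holomorphic_on_compose_gen[OF _ \<phi>]) (use inb in \<open>auto intro!: holomorphic_intros\<close>)
    then show ?thesis unfolding \<psi>_def o_def
      by (intro holomorphic_intros) (use den in auto)
  qed
  have \<psi>lt: "norm (\<psi> \<zeta>) < 1" if "norm \<zeta> < 1" for \<zeta>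
  proof -
    let ?p = "\<phi> (R * \<zeta>)"
    have "(norm ?p)\<^sup>2 < (norm (2 * complex_of_real A - ?p))\<^sup>2"
    proof -
      have "A * Re ?p < A * A" using Re[OF inb[OF that]] A by simp
      then show ?thesis
        unfolding cmod_power2 by (simp add: power2_eq_square algebra_simps)
    qed
    then have "norm ?p < norm (2 * complex_of_real A - ?p)" by (simp add: power_less_imp_less_base)
    then show ?thesis using den[OF that] by (simp add: \<psi>_def norm_divide)
  qed
  define \<zeta> where "\<zeta> = z / of_real R"
  have n\<zeta>: "norm \<zeta> = norm z / R" using R by (simp add: \<zeta>_def norm_divide)
  have \<zeta>1: "norm \<zeta> < 1" using zR R by (simp add: n\<zeta>)
  have Rz: "of_real R * \<zeta> = z" using R by (simp add: \<zeta>_def)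
  have sch: "norm (\<psi> \<zeta>) \<le> norm \<zeta>"
    by (rule Schwarz_Lemma(1)[OF \<psi>hol _ \<psi>lt \<zeta>1]) (simp_all add: \<psi>_def \<phi>0)
  have dz: "2 * complex_of_real A - \<phi> z \<noteq> 0" using den[OF \<zeta>1] by (simp add: Rz)
  have pz: "\<psi> \<zeta> * (2 * complex_of_real A - \<phi> z) = \<phi> z" using dz by (simp add: \<psi>_def Rz)
  have "norm (\<phi> z) \<le> norm \<zeta> * (2 * A + norm (\<phi> z))"
  proof -
    have "norm (\<phi> z) = norm (\<psi> \<zeta>) * norm (2 * complex_of_real A - \<phi> z)"
      using pz by (metis norm_mult)
    also have "\<dots> \<le> norm \<zeta> * (2 * A + norm (\<phi> z))"
    proof (rule mult_mono[OF sch])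
      have "norm (2 * complex_of_real A - \<phi> z) \<le> norm (2 * complex_of_real A) + norm (\<phi> z)"
        by (rule norm_triangle_ineq4)
      then show "norm (2 * complex_of_real A - \<phi> z) \<le> 2 * A + norm (\<phi> z)"
        using A by (simp add: norm_mult)
    qed auto
    finally show ?thesis .
  qed
  then have "norm (\<phi> z) \<le> norm z / R * (2 * A + norm (\<phi> z))" by (simp add: n\<zeta>)
  then have "norm (\<phi> z) * R \<le> norm z * (2 * A + norm (\<phi> z))" using R by (simp add: field_simps)
  then have "norm (\<phi> z) \<le> 2 * A * norm z / (R - norm z)" using zR by (simp add: field_simps)
  then show ?thesis using that e[of z] zR by auto
qed

lemma powr_dominates:
  fixes b c K d :: real
  assumes "b < c" "0 < c" "d > 0"
  shows "filterlim (\<lambda>s. K * s powr b - d * s powr c) at_bot at_top"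
proof -
  have "((\<lambda>s. K * s powr (b - c) - d) \<longlongrightarrow> K * 0 - d) at_top"
    by (intro tendsto_intros tendsto_neg_powr) (use assms in \<open>auto intro: filterlim_ident\<close>)
  then have 1: "((\<lambda>s. K * s powr (b - c) - d) \<longlongrightarrow> - d) at_top" by simp
  have "filterlim (\<lambda>s::real. s powr c) at_top at_top"
    using assms by real_asymp
  then have "filterlim (\<lambda>s. (K * s powr (b - c) - d) * s powr c) at_bot at_top"
    by (intro filterlim_tendsto_neg_mult_at_bot[OF 1]) (use assms in auto)
  moreover have "\<forall>\<^sub>F s in at_top. (K * s powr (b - c) - d) * s powr c = K * s powr b - d * s powr c"
    using eventually_gt_at_top[of 0]
    by eventually_elim (simp add: algebra_simps powr_diff)
  ultimately show ?thesis by (simp cong: filterlim_cong)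
qed

text \<open>Multiplying \<open>H\<close> by the exponential of
  \<open>- \<epsilon> * (1 - \<i> * z) powr c\<close> with \<open>b < c < 1\<close> beats the growth
  of \<open>H\<close> on large arcs, while the factor has modulus at most 1 on the real line. The
  maximum principle on half-discs bounds the product by \<open>B\<close>; then
  \<open>\<epsilon>\<close> tends to 0.\<close>

lemma phragmen_lindelof_halfplane:
  fixes H :: "complex \<Rightarrow> complex"
  assumes hol: "H holomorphic_on UNIV" and B: "B > 0"
    and real: "\<And>x::real. norm (H (of_real x)) \<le> B"
    and grow: "\<And>z. norm (H z) \<le> exp (K * norm z powr b)"
    and b: "0 < b" "b < 1" and z: "Im z \<ge> 0"
  shows "norm (H z) \<le> B"
proof -
  define c where "c = (b + 1) / 2"
  have c: "b < c" "c < 1" "0 < c" using b by (auto simp: c_def)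
  define \<delta> where "\<delta> = cos (c * pi / 2)"
  have "0 < c * pi" "c * pi < pi" using c by auto
  then have \<delta>: "\<delta> > 0" unfolding \<delta>_def by (intro cos_gt_zero_pi) linarith+
  \<comment> \<open>The shift by 1 keeps the base of the power off the branch cut even slightly
    below the real line. In the closed upper half-plane the argument of the base is less than
    \<open>pi / 2\<close> in absolute value, so the real part of the power is at least
    \<open>\<delta>\<close> times its modulus.\<close>
  define P where "P = (\<lambda>z::complex. (1 - \<i> * z) powr of_real c)"
  have ReP: "Re (P z) \<ge> \<delta> * norm z powr c" if "Im z \<ge> 0" for z
  proof -
    let ?w = "1 - \<i> * z"
    have w: "Re ?w > 0" using that by simp
    then have wn: "?w \<noteq> 0" by (metis zero_complex.sel(1) less_irrefl)
    define t where "t = Im (Ln ?w)"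
    have t: "\<bar>t\<bar> < pi / 2" unfolding t_def by (rule Re_Ln_pos_lt_imp[OF w])
    have "\<delta> \<le> cos (c * t)"
    proof -
      have "\<bar>c * t\<bar> \<le> c * pi / 2" using t c by (simp add: abs_mult)
      moreover have "c * pi / 2 \<le> pi" using c by (simp add: field_simps)
      ultimately have "cos (c * pi / 2) \<le> cos \<bar>c * t\<bar>" by (intro cos_monotone_0_pi_le) auto
      then show ?thesis by (simp add: \<delta>_def)
    qed
    moreover have "norm z \<le> norm ?w"
    proof -
      have "(norm z)\<^sup>2 \<le> (norm ?w)\<^sup>2"
        using that unfolding cmod_power2 by (simp add: power2_eq_square algebra_simps)
      then show ?thesis by (rule power2_le_imp_le) simp
    qed
    then have "norm z powr c \<le> norm ?w powr c" using c by (intro powr_mono2) simp_all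
    moreover have "Re (P z) = norm ?w powr c * cos (c * t)"
      using wn by (simp only: P_def powr_def Re_exp t_def if_False) (simp add: powr_def)
    ultimately show ?thesis
      using mult_mono[of \<delta> "cos (c * t)" "norm z powr c" "norm ?w powr c"] \<delta> by (simp add: mult.commute)
  qed
  have key: "norm (H z) * exp (- \<epsilon> * Re (P z)) \<le> B" if \<epsilon>: "\<epsilon> > 0" for \<epsilon>
  proof -
    define E where "E = (\<lambda>z. H z * exp (- of_real \<epsilon> * P z))"
    have nE: "norm (E z) = norm (H z) * exp (- \<epsilon> * Re (P z))" for z
      by (simp add: E_def norm_mult)
    have "filterlim (\<lambda>s. K * s powr b - \<epsilon> * \<delta> * s powr c) at_bot at_top"
      by (rule powr_dominates) (use c \<delta> \<epsilon> in auto)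
    then have "\<forall>\<^sub>F s in at_top. K * s powr b - \<epsilon> * \<delta> * s powr c \<le> ln B \<and> s > norm z"
      by (auto simp: filterlim_at_bot intro!: eventually_conj eventually_gt_at_top)
    then obtain s where s: "K * s powr b - \<epsilon> * \<delta> * s powr c \<le> ln B" "s > norm z"
      by (auto simp: eventually_at_top_linorder)
    \<comment> \<open>The boundary of this half-disc consists of a real segment, where
      \<open>real\<close> applies, and an arc, where \<open>s\<close> is so large that the damping
      factor outweighs the growth.\<close>
    define S where "S = ball 0 s \<inter> {z. Im z > 0}"
    have Sop: "open S" unfolding S_def by (intro open_Int open_ball open_halfspace_Im_gt)
    have clS: "closure S \<subseteq> cball 0 s \<inter> {z. Im z \<ge> 0}"
      by (rule closure_minimal) (auto simp: S_def intro!: closed_Int closed_halfspace_Im_ge)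
    have Ehol: "E holomorphic_on {z. Im z > -1}"
    proof -
      have "(1 - \<i> * z) \<notin> \<real>\<^sub>\<le>\<^sub>0" if "Im z > -1" for z
        using that by (auto simp: complex_nonpos_Reals_iff)
      then show ?thesis unfolding E_def P_def
        by (intro holomorphic_intros holomorphic_on_subset[OF hol]) auto
    qed
    have onreal: "norm (E \<xi>) \<le> B" if "Im \<xi> = 0" for \<xi>
    proof -
      have "norm (H \<xi>) \<le> B" using real[of "Re \<xi>"] that by (simp add: complex_is_Real_iff)
      moreover have "0 \<le> Re (P \<xi>)"
        using ReP[of \<xi>] that \<delta> by (smt (verit) mult_nonneg_nonneg powr_ge_zero)
      then have "exp (- \<epsilon> * Re (P \<xi>)) \<le> 1" using \<epsilon> by simp
      ultimately show ?thesis
        unfolding nE using mult_mono[of "norm (H \<xi>)" B "exp (- \<epsilon> * Re (P \<xi>))" 1] B by simp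
    qed
    have fr: "norm (E \<xi>) \<le> B" if \<xi>: "\<xi> \<in> frontier S" for \<xi>
    proof -
      have c1: "norm \<xi> \<le> s" "Im \<xi> \<ge> 0" using \<xi> clS by (auto simp: frontier_def)
      have ns: "\<xi> \<notin> S" using \<xi> Sop by (simp add: frontier_def interior_open)
      show ?thesis
      proof (cases "Im \<xi> = 0")
        case True
        then show ?thesis by (rule onreal)
      next
        case False
        then have "norm \<xi> = s" using c1 ns by (auto simp: S_def)
        then have "norm (E \<xi>) \<le> exp (K * s powr b) * exp (- \<epsilon> * (\<delta> * s powr c))"
          unfolding nE using ReP[OF c1(2)] \<epsilon> grow[of \<xi>] by (intro mult_mono) (auto simp: algebra_simps)
        also have "\<dots> = exp (K * s powr b - \<epsilon> * \<delta> * s powr c)"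
          by (simp add: exp_add[symmetric])
        also have "\<dots> \<le> exp (ln B)" using s(1) by simp
        finally show ?thesis using B by simp
      qed
    qed
    have "norm (E z) \<le> B" 
    proof (cases "z \<in> S")
      case True
      show ?thesis
      proof (rule maximum_modulus_frontier[OF _ _ _ fr True])
        show "E holomorphic_on interior S"
          unfolding interior_open[OF Sop] by (rule holomorphic_on_subset[OF Ehol]) (auto simp: S_def)
        show "continuous_on (closure S) E"
          by (rule holomorphic_on_imp_continuous_on, rule holomorphic_on_subset[OF Ehol])
             (use clS in fastforce)
        show "bounded S" by (rule bounded_subset[OF bounded_ball]) (auto simp: S_def)
      qed
    next
      case False
      then have "Im z = 0" using z s by (auto simp: S_def)
      then show ?thesis by (rule onreal)
    qed
    then show ?thesis by (simp add: nE)
  qed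
  have "((\<lambda>\<epsilon>. norm (H z) * exp (- \<epsilon> * Re (P z))) \<longlongrightarrow> norm (H z) * exp (- 0 * Re (P z))) (at_right 0)"
    by (intro tendsto_intros)
  then have "norm (H z) * exp (- 0 * Re (P z)) \<le> B"
    by (rule tendsto_upperbound) (use key in \<open>auto simp: eventually_at_filter\<close>)
  then show ?thesis by simp
qed

text \<open>Squaring maps the closed upper half-plane onto the plane and the real line onto the
  positive axis. It doubles the growth exponent, so \<open>b < 1/2\<close> is what the half-plane
  principle needs; Liouville's theorem then applies.\<close>

lemma entire_bounded_on_positive_reals_constant:
  fixes G :: "complex \<Rightarrow> complex"
  assumes hol: "G holomorphic_on UNIV"
    and real: "\<And>x::real. x \<ge> 0 \<Longrightarrow> norm (G (of_real x)) \<le> B"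
    and grow: "\<And>z. norm (G z) \<le> exp (K * norm z powr b)"
    and b: "0 < b" "b < 1/2"
  shows "G constant_on UNIV"
proof -
  define B' where "B' = max B 1"
  have bd: "norm (G z) \<le> B'" for z
  proof -
    obtain \<zeta> where \<zeta>: "\<zeta>\<^sup>2 = z" "Im \<zeta> \<ge> 0"
      by (metis linorder_linear neg_0_le_iff_le power2_csqrt power2_minus uminus_complex.sel(2))
    have "norm (G (\<zeta>\<^sup>2)) \<le> B'"
    proof (rule phragmen_lindelof_halfplane[where H = "\<lambda>\<zeta>. G (\<zeta>\<^sup>2)" and b = "2 * b" and K = K])
      show "(\<lambda>\<zeta>. G (\<zeta>\<^sup>2)) holomorphic_on UNIV"
        using holomorphic_on_compose_gen[of "\<lambda>z. z\<^sup>2" UNIV G UNIV] hol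
        by (simp add: o_def holomorphic_intros)
      show "norm (G ((of_real x)\<^sup>2)) \<le> B'" for x
        using real[of "x\<^sup>2"] by (simp add: B'_def)
      show "norm (G (z\<^sup>2)) \<le> exp (K * norm z powr (2 * b))" for z
        using grow[of "z\<^sup>2"] by (simp add: norm_power powr_powr[symmetric])
    qed (use b \<zeta> in \<open>auto simp: B'_def\<close>)
    then show ?thesis by (simp add: \<zeta>)
  qed
  show ?thesis by (rule Liouville_theorem[OF hol]) (use bd in \<open>auto simp: bounded_iff\<close>)
qed

section \<open>Factorization in genus zero\<close>

text \<open>The class is designed to be stable under dividing out a zero: the constant
  \<open>K\<close> absorbs bounded changes, and the last clause, which excludes polynomials, ensures
  that the zeros never run out.\<close>

definition transcendental_of_growth :: "real \<Rightarrow> (complex \<Rightarrow> complex) \<Rightarrow> bool" where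
  "transcendental_of_growth s h \<longleftrightarrow> h holomorphic_on UNIV \<and> h 0 = 1 \<and>
     (\<exists>K. \<forall>z. norm (h z) \<le> exp (K + norm z powr s)) \<and>
     (\<forall>C d. \<exists>z. norm (h z) > C * (1 + norm z) ^ d)"

lemma transcendental_of_growth_obtain_bound:
  assumes "transcendental_of_growth s h"
  obtains K where "K \<ge> 0" "\<And>z. norm (h z) \<le> exp (K + norm z powr s)"
proof -
  obtain K where K: "\<And>z. norm (h z) \<le> exp (K + norm z powr s)"
    using assms by (auto simp: transcendental_of_growth_def)
  have "norm (h z) \<le> exp (\<bar>K\<bar> + norm z powr s)" for z
    by (rule order_trans[OF K]) simp
  then show ?thesis using that[of "\<bar>K\<bar>"] by simp
qed

text \<open>This is the Borel-Caratheodory bound at a fixed point of modulus \<open>c\<close> in a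
  disc of radius \<open>r\<close>; it vanishes because the growth exponent is below 1. The factor 3
  comes from the circles of radius \<open>3 * norm (a n)\<close> used in the factorization.\<close>

lemma borel_caratheodory_bound_tendsto_0:
  fixes K s c :: real
  assumes "0 < s" "s < 1"
  shows "((\<lambda>r. 2 * (K + 1 + (3 * r) powr s) * c / (r - c)) \<longlongrightarrow> 0) at_top"
  using assms by real_asymp

text \<open>Without zeros, \<open>h\<close> would have logarithms at \<open>z\<close> of arbitrarily
  small modulus by Borel-Caratheodory on growing discs, hence modulus at most 1 everywhere, which
  the non-polynomial clause forbids. A zero of least modulus exists since the zero set is
  closed.\<close>

lemma transcendental_of_growth_minimal_zero:
  assumes h: "transcendental_of_growth s h" and s: "0 < s" "s < 1"
  obtains a where "h a = 0" "\<And>z. norm z < norm a \<Longrightarrow> h z \<noteq> 0"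
proof -
  have hol: "h holomorphic_on UNIV" and h0: "h 0 = 1"
    and np: "\<And>C d. \<exists>z. norm (h z) > C * (1 + norm z) ^ d"
    using h by (auto simp: transcendental_of_growth_def)
  obtain K where K: "K \<ge> 0" "\<And>z. norm (h z) \<le> exp (K + norm z powr s)"
    using transcendental_of_growth_obtain_bound[OF h] by blast
  have "\<exists>a. h a = 0"
  proof (rule ccontr)
    assume "\<nexists>a. h a = 0"
    then have nz: "h z \<noteq> 0" for z by blast
    have "norm (h z) \<le> 1" for z
    proof -
      have "\<forall>\<^sub>F r in at_top. norm (h z) \<le> exp (2 * (K + 1 + (3 * r) powr s) * norm z / (r - norm z))"
        using eventually_gt_at_top[of "norm z"]
      proof eventually_elim
        case (elim r)
        have A: "K + 1 + (3 * r) powr s > 0" using K powr_ge_zero by (smt (verit))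
        have bd: "norm (h w) < exp (K + 1 + (3 * r) powr s)" if "w \<in> ball 0 r" for w
        proof -
          have "norm w \<le> 3 * r" using that norm_ge_zero[of w] unfolding mem_ball_0 by linarith
          then have "norm w powr s \<le> (3 * r) powr s" using s by (intro powr_mono2) auto
          then show ?thesis using K(2)[of w] by (smt (verit) exp_less_cancel_iff)
        qed
        obtain L where "h z = exp L" "norm L \<le> 2 * (K + 1 + (3 * r) powr s) * norm z / (r - norm z)"
          using borel_caratheodory_exp[OF holomorphic_on_subset[OF hol] h0 nz bd A elim] by auto
        then show ?case using norm_exp[of L] by (metis exp_le_cancel_iff order_trans)
      qed
      moreover have "((\<lambda>r. exp (2 * (K + 1 + (3 * r) powr s) * norm z / (r - norm z))) \<longlongrightarrow> exp 0) at_top"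
        by (intro tendsto_exp borel_caratheodory_bound_tendsto_0 s)
      ultimately have "norm (h z) \<le> exp 0"
        by (intro tendsto_lowerbound[OF _ _ trivial_limit_at_top_linorder])
      then show ?thesis by simp
    qed
    then show False using np[of 1 0] by (auto simp: not_le[symmetric])
  qed
  then have ne: "{z. h z = 0} \<noteq> {}" by auto
  have "closed (h -` {0})"
    using hol by (intro continuous_closed_vimage)
      (auto dest: holomorphic_on_imp_continuous_on simp: continuous_on_eq_continuous_at)
  moreover have "h -` {0} = {z. h z = 0}" by auto
  ultimately have cl: "closed {z. h z = 0}" by simp
  obtain a where "a \<in> {z. h z = 0}" "\<And>y. y \<in> {z. h z = 0} \<Longrightarrow> dist 0 a \<le> dist 0 y"
    using distance_attains_inf[OF cl ne, of 0] by blast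
  then show ?thesis by (intro that[of a]) force+
qed

text \<open>Outside the disc of radius \<open>2 * norm a\<close> the removed factor has modulus at
  least 1, so \<open>g\<close> inherits the bound of \<open>h\<close>; inside, compactness suffices.
  A polynomial bound of degree \<open>d\<close> on \<open>g\<close> would give one of degree
  \<open>d + 1\<close> on \<open>h\<close>.\<close>

lemma transcendental_of_growth_divide_zero:
  assumes h: "transcendental_of_growth s h" and a: "h a = 0" and s: "0 < s"
  obtains g where "transcendental_of_growth s g" "\<And>z. h z = (1 - z / a) * g z"
proof -
  have hol: "h holomorphic_on UNIV" and h0: "h 0 = 1"
    and np: "\<And>C d. \<exists>z. norm (h z) > C * (1 + norm z) ^ d"
    using h by (auto simp: transcendental_of_growth_def)
  have a0: "a \<noteq> 0" using a h0 by auto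
  obtain K where K: "K \<ge> 0" "\<And>z. norm (h z) \<le> exp (K + norm z powr s)"
    using transcendental_of_growth_obtain_bound[OF h] by blast
  define q where "q = (\<lambda>z. if z = a then deriv h a else h z / (z - a))"
  have q: "q holomorphic_on UNIV"
    by (rule pole_theorem_0[OF hol, of a]) (auto simp: q_def a)
  define g where "g = (\<lambda>z. - a * q z)"
  have g: "g holomorphic_on UNIV" unfolding g_def by (intro holomorphic_intros q)
  have hg: "h z = (1 - z / a) * g z" for z
    using a0 a by (auto simp: g_def q_def field_simps)
  have "compact (g ` cball 0 (2 * norm a))"
    by (intro compact_continuous_image holomorphic_on_imp_continuous_on holomorphic_on_subset[OF g]) auto
  then obtain B where B: "B > 0" "\<And>z. norm z \<le> 2 * norm a \<Longrightarrow> norm (g z) \<le> B"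
    using compact_imp_bounded bounded_pos by (metis (no_types, lifting) imageI mem_cball_0)
  have gr: "norm (g z) \<le> exp (max K (ln B) + norm z powr s)" for z
  proof (cases "norm z \<le> 2 * norm a")
    case True
    have "norm (g z) \<le> exp (ln B)" using B True by simp
    also have "\<dots> \<le> exp (max K (ln B) + norm z powr s)"
      by (simp add: add_increasing2)
    finally show ?thesis .
  next
    case False
    have "1 \<le> norm (1 - z / a)"
    proof -
      have "norm (z / a) - norm (1::complex) \<le> norm (1 - z / a)"
        by (metis norm_minus_commute norm_triangle_ineq2)
      moreover have "norm (z / a) \<ge> 2" using False a0 by (simp add: norm_divide field_simps)
      ultimately show ?thesis by simp
    qed
    then have "norm (g z) \<le> norm (h z)" by (simp add: hg norm_mult mult_le_cancel_right1)
    also have "\<dots> \<le> exp (max K (ln B) + norm z powr s)" by (rule order_trans[OF K(2)]) simp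
    finally show ?thesis .
  qed
  have npg: "\<exists>z. norm (g z) > C * (1 + norm z) ^ d" for C d
  proof (rule ccontr)
    assume "\<nexists>z. norm (g z) > C * (1 + norm z) ^ d"
    then have gl: "norm (g z) \<le> C * (1 + norm z) ^ d" for z by (meson not_le)
    obtain z where z: "norm (h z) > (C * (1 + 1 / norm a)) * (1 + norm z) ^ Suc d" using np by blast
    have C: "C \<ge> 0" using gl[of 0] by (simp add: order_trans[OF norm_ge_zero])
    have "norm (1 - z / a) \<le> 1 + norm z / norm a"
      by (metis norm_divide norm_one norm_triangle_ineq4)
    also have "\<dots> \<le> (1 + 1 / norm a) * (1 + norm z)"
      using a0 by (simp add: field_simps)
    finally have "norm (h z) \<le> ((1 + 1 / norm a) * (1 + norm z)) * (C * (1 + norm z) ^ d)"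
      unfolding hg norm_mult using gl[of z] a0 by (intro mult_mono) auto
    then show False using z by (simp add: mult_ac)
  qed
  have "transcendental_of_growth s g"
    unfolding transcendental_of_growth_def using g gr npg hg[of 0] h0 by auto
  then show ?thesis using that hg by blast
qed

lemma transcendental_of_growth_successive_division:
  assumes h: "transcendental_of_growth s h" and s: "0 < s" "s < 1"
  obtains F a where "F 0 = h" "\<And>n. transcendental_of_growth s (F n)" "\<And>n::nat. F n (a n) = 0"
    "\<And>n z. norm z < norm (a n) \<Longrightarrow> F n z \<noteq> 0"
    "\<And>n z. F n z = (1 - z / a n) * F (Suc n) z"
proof -
  \<comment> \<open>The states of the recursion are pairs of a quotient and one of its zeros of
    least modulus; the clause for index 0 starts the sequence at \<open>h\<close>.\<close>
  define P where "P = (\<lambda>n x. transcendental_of_growth s (fst x) \<and> fst x (snd x) = 0 \<and>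
    (\<forall>z. norm z < norm (snd x) \<longrightarrow> fst x z \<noteq> 0) \<and> (n = (0::nat) \<longrightarrow> fst x = h))"
  define Q where "Q = (\<lambda>(n::nat) x y. \<forall>z::complex. fst x z = (1 - z / snd x) * fst (y :: (complex \<Rightarrow> complex) \<times> complex) z)"
  have "\<exists>x. P 0 x"
    using transcendental_of_growth_minimal_zero[OF h s] h unfolding P_def by (metis fst_conv snd_conv)
  moreover have "\<exists>y. P (Suc n) y \<and> Q n x y" if "P n x" for n x
  proof -
    have x: "transcendental_of_growth s (fst x)" "fst x (snd x) = 0" using that by (auto simp: P_def)
    obtain g where g: "transcendental_of_growth s g" "\<And>z. fst x z = (1 - z / snd x) * g z"
      using transcendental_of_growth_divide_zero[OF x s(1)] by blast
    obtain b where "g b = 0" "\<And>z. norm z < norm b \<Longrightarrow> g z \<noteq> 0"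
      using transcendental_of_growth_minimal_zero[OF g(1) s] by blast
    then have "P (Suc n) (g, b) \<and> Q n x (g, b)" using g by (auto simp: P_def Q_def)
    then show ?thesis by blast
  qed
  ultimately obtain X where X: "\<And>n. P n (X n)" "\<And>n. Q n (X n) (X (Suc n))"
    using dependent_nat_choice[of P Q] by blast
  show ?thesis
  proof (rule that[of "\<lambda>n. fst (X n)" "\<lambda>n. snd (X n)"])
    show "fst (X n) z = (1 - z / snd (X n)) * fst (X (Suc n)) z" for n z
      using X(2)[of n] unfolding Q_def by blast
  qed (use X(1) in \<open>auto simp: P_def\<close>)
qed

text \<open>Dividing by the factors of the first \<open>n\<close> zeros gains \<open>2 ^ n\<close> on a circle of three times
  their modulus; evaluating at the origin then bounds \<open>n\<close>, which replaces Jensen's formula.\<close>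

lemma genus_zero_factorization:
  assumes h: "transcendental_of_growth s h" and s: "0 < s" "s < 1"
  obtains a where "\<And>n::nat. a n \<noteq> 0" "\<And>b. b > s \<Longrightarrow> summable (\<lambda>n. norm (a n) powr - b)"
    "\<And>z. (\<lambda>n. \<Prod>i<n. 1 - z / a i) \<longlonglongrightarrow> h z"
proof -
  obtain F a where F0: "F 0 = h" and F: "\<And>n. transcendental_of_growth s (F n)"
    and Fa: "\<And>n::nat. F n (a n) = 0"
    and Fnz: "\<And>n z. norm z < norm (a n) \<Longrightarrow> F n z \<noteq> 0"
    and FS: "\<And>n z. F n z = (1 - z / a n) * F (Suc n) z"
    using transcendental_of_growth_successive_division[OF h s] by metis
  have Fhol: "F n holomorphic_on A" and FO: "F n 0 = 1" for n A
    using F[of n] by (auto simp: transcendental_of_growth_def intro: holomorphic_on_subset)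
  have a0: "a n \<noteq> 0" for n using Fa[of n] FO[of n] by auto
  obtain K where K: "K \<ge> 0" "\<And>z. norm (h z) \<le> exp (K + norm z powr s)"
    using transcendental_of_growth_obtain_bound[OF h] by blast
  \<comment> \<open>Each \<open>a (Suc n)\<close> is also a zero of \<open>F n\<close>, so the
    minimality of \<open>a n\<close> orders the moduli.\<close>
  have mono: "norm (a i) \<le> norm (a n)" if "i \<le> n" for i n
    using that
  proof (induction rule: dec_induct)
    case (step n)
    have "F n (a (Suc n)) = 0" using FS[of n] Fa[of "Suc n"] by simp
    then show ?case using Fnz[of "a (Suc n)" n] step by (meson not_le order_trans)
  qed simp
  have prod: "h z = (\<Prod>i<n. 1 - z / a i) * F n z" for n z
  proof (induction n)
    case (Suc n)
    then show ?case using FS[of n z] by simp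
  qed (simp add: F0)
  have bound: "2 ^ n * norm (F n z) \<le> exp (K + (3 * norm (a n)) powr s)" if "norm z \<le> 3 * norm (a n)" for n z
  proof -
    have "norm (F n z) \<le> exp (K + (3 * norm (a n)) powr s) / 2 ^ n"
    proof (rule maximum_modulus_frontier[of "F n" "cball 0 (3 * norm (a n))"])
      fix w :: complex assume "w \<in> frontier (cball 0 (3 * norm (a n)))"
      then have w: "norm w = 3 * norm (a n)" using a0[of n] by (simp add: frontier_cball)
      have "2 \<le> norm (1 - w / a i)" if "i < n" for i
      proof -
        have "norm (w / a i) \<ge> 3" using mono[of i n] that w a0[of i] by (simp add: norm_divide field_simps)
        moreover have "norm (w / a i) - norm (1::complex) \<le> norm (1 - w / a i)"
          by (metis norm_minus_commute norm_triangle_ineq2)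
        ultimately show ?thesis by simp
      qed
      then have "(\<Prod>i<n. 2) \<le> (\<Prod>i<n. norm (1 - w / a i))" by (intro prod_mono) auto
      then have "2 ^ n * norm (F n w) \<le> norm (h w)"
        by (subst prod[of w n]) (auto simp: norm_mult prod_norm intro!: mult_right_mono)
      also have "\<dots> \<le> exp (K + (3 * norm (a n)) powr s)" using K(2)[of w] w by simp
      finally show "norm (F n w) \<le> exp (K + (3 * norm (a n)) powr s) / 2 ^ n"
        by (simp add: field_simps)
    qed (use that in \<open>auto intro!: Fhol holomorphic_on_imp_continuous_on\<close>)
    then show ?thesis by (simp add: field_simps)
  qed
  have count: "n / 2 \<le> K + (3 * norm (a n)) powr s" for n
  proof -
    have "2 ^ n \<le> exp (K + (3 * norm (a n)) powr s)" using bound[of 0 n] by (simp add: FO)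
    then have "ln (2 ^ n) \<le> K + (3 * norm (a n)) powr s"
      by (metis ln_exp ln_le_cancel_iff exp_gt_zero zero_less_numeral zero_less_power)
    moreover have "n / 2 \<le> ln (2 ^ n :: real)"
      using ln2_ge_two_thirds by (simp add: ln_realpow mult_left_mono[of "1/2" "ln 2" "real n", simplified])
    ultimately show ?thesis by simp
  qed
  have summ: "summable (\<lambda>n. norm (a n) powr - b)" if b: "b > s" for b
  proof (rule summable_comparison_test_ev)
    \<comment> \<open>Once \<open>K\<close> is at most a quarter of \<open>n\<close>, the counting
      bound leaves \<open>n / 4\<close> for the power of \<open>3 * norm (a n)\<close>; this gives
      the 4 and the power of 3. The series is then compared with the powers of \<open>n\<close> with
      exponent \<open>-(b / s)\<close>, which is below -1.\<close>
    define c where "c = 4 * 3 powr s"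
    have c: "c > 0" by (simp add: c_def)
    have "-(b / s) < -1" using b s by (simp add: field_simps)
    then have "summable (\<lambda>n. real n powr -(b / s))" by (simp add: summable_real_powr_iff)
    then show "summable (\<lambda>n. c powr (b / s) * real n powr -(b / s))" by (rule summable_mult)
    show "\<forall>\<^sub>F n in sequentially. norm (norm (a n) powr - b) \<le> c powr (b / s) * real n powr -(b / s)"
      using eventually_gt_at_top[of "max 1 (nat \<lceil>4 * K\<rceil>)"]
    proof eventually_elim
      case (elim n)
      then have n: "real n > 0" "K \<le> real n / 4" by linarith+
      have "real n / 4 \<le> (3 * norm (a n)) powr s" using count[of n] n by linarith
      then have le: "real n / c \<le> norm (a n) powr s"
        by (simp add: c_def powr_mult field_simps)
      have "norm (a n) powr - b = (norm (a n) powr s) powr -(b / s)"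
        using s by (simp add: powr_powr)
      also have "\<dots> \<le> (real n / c) powr -(b / s)"
        by (rule powr_mono2') (use le n c b s in auto)
      also have "\<dots> = c powr (b / s) * real n powr -(b / s)"
        using n c by (simp add: powr_divide powr_minus field_simps)
      finally show ?case by simp
    qed
  qed
  have top: "filterlim (\<lambda>n. norm (a n)) at_top sequentially"
  proof -
    have "(\<lambda>n. norm (a n) powr - 1) \<longlonglongrightarrow> 0" using summ[of 1] s by (intro summable_LIMSEQ_zero) auto
    then have "(\<lambda>n. inverse (norm (a n))) \<longlonglongrightarrow> 0" by (simp add: powr_minus)
    then have "filterlim (\<lambda>n. inverse (inverse (norm (a n)))) at_top sequentially"
      by (rule filterlim_inverse_at_top) (simp add: a0)
    then show ?thesis by simp
  qed
  \<comment> \<open>The remaining factor \<open>F n\<close> has no zeros in the disc of radius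
    \<open>norm (a n)\<close> and satisfies the growth bound there, so Borel-Caratheodory gives it a
    logarithm at \<open>z\<close> that tends to 0 as the discs grow.\<close>
  have lim: "(\<lambda>n. \<Prod>i<n. 1 - z / a i) \<longlonglongrightarrow> h z" for z
  proof -
    let ?b = "\<lambda>r. 2 * (K + 1 + (3 * r) powr s) * norm z / (r - norm z)"
    have "(\<lambda>n. ?b (norm (a n))) \<longlonglongrightarrow> 0"
      by (rule filterlim_compose[OF borel_caratheodory_bound_tendsto_0[OF s] top])
    moreover have "\<exists>L. norm z < norm (a n) \<longrightarrow> F n z = exp L \<and> norm L \<le> ?b (norm (a n))" for n
    proof (cases "norm z < norm (a n)")
      case True
      let ?R = "norm (a n)"
      have A: "K + 1 + (3 * ?R) powr s > 0" using K powr_ge_zero by (smt (verit))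
      have bd: "norm (F n w) < exp (K + 1 + (3 * ?R) powr s)" if "w \<in> ball 0 ?R" for w
      proof -
        have "norm (F n w) \<le> 2 ^ n * norm (F n w)" by (simp add: mult_le_cancel_right1)
        also have "\<dots> \<le> exp (K + (3 * ?R) powr s)" using that norm_ge_zero[of w] unfolding mem_ball_0
          by (intro bound) linarith
        also have "\<dots> < exp (K + 1 + (3 * ?R) powr s)" by simp
        finally show ?thesis .
      qed
      show ?thesis
        using borel_caratheodory_exp[OF Fhol FO _ bd A True] Fnz by (metis mem_ball_0)
    qed auto
    then obtain L where L: "\<And>n. norm z < norm (a n) \<Longrightarrow> F n z = exp (L n) \<and> norm (L n) \<le> ?b (norm (a n))"
      by metis
    have ev: "\<forall>\<^sub>F n in sequentially. norm z < norm (a n)"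
      using top by (simp add: filterlim_at_top_dense)
    have "L \<longlonglongrightarrow> 0"
      by (rule Lim_null_comparison[of _ "\<lambda>n. ?b (norm (a n))"])
        (use ev L calculation in \<open>auto elim: eventually_mono\<close>)
    then have "(\<lambda>n. h z * exp (- L n)) \<longlonglongrightarrow> h z * exp (- 0)" by (intro tendsto_intros)
    moreover have "\<forall>\<^sub>F n in sequentially. h z * exp (- L n) = (\<Prod>i<n. 1 - z / a i)"
      using ev
    proof eventually_elim
      case (elim n)
      then show ?case using L[of n] by (subst prod[of z n]) (simp add: exp_minus)
    qed
    ultimately show ?thesis by (simp add: tendsto_cong)
  qed
  show ?thesis using that[of a] a0 summ lim by blast
qed

section \<open>Minimum modulus\<close>

text \<open>Factor by factor, \<open>(1 + x) powr b\<close> is at most \<open>1 + x powr b\<close>,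
  hence at most the exponential of \<open>x powr b\<close>; taking the power \<open>1 / b\<close>
  gives a bound that can be summed. It converts convergence of the zeros with exponent
  \<open>b\<close> into growth of exponent \<open>b\<close>.\<close>

lemma prod_one_plus_le_exp_powr:
  fixes p :: "nat \<Rightarrow> real"
  assumes p: "\<And>i. p i > 0" and b: "0 < b" "b \<le> 1" and r: "r \<ge> 0"
    and sm: "summable (\<lambda>i. p i powr - b)"
  shows "(\<Prod>i<N. 1 + r / p i) \<le> exp ((\<Sum>i. p i powr - b) / b * r powr b)"
proof -
  have one: "1 + x \<le> exp (x powr b / b)" if "x \<ge> 0" for x :: real
  proof -
    have "(1 + x) powr b \<le> 1 + x powr b"
    proof (cases "x = 0")
      case False
      then have x: "x > 0" using that by simp
      have "(1 + x) powr b = (1 + x) * (1 + x) powr (b - 1)"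
        using x by (simp add: powr_diff)
      also have "\<dots> = (1 + x) powr (b - 1) + x * (1 + x) powr (b - 1)" by (simp add: algebra_simps)
      also have "\<dots> \<le> 1 + x * x powr (b - 1)"
      proof (intro add_mono mult_left_mono)
        show "(1 + x) powr (b - 1) \<le> 1" using powr_mono[of "b - 1" 0 "1 + x"] b x by simp
        show "(1 + x) powr (b - 1) \<le> x powr (b - 1)" by (rule powr_mono2') (use b x in auto)
      qed (use x in auto)
      also have "x * x powr (b - 1) = x powr b" using x by (simp add: powr_diff)
      finally show ?thesis .
    qed simp
    also have "\<dots> \<le> exp (x powr b)" by (rule exp_ge_add_one_self)
    finally have "((1 + x) powr b) powr (1 / b) \<le> exp (x powr b) powr (1 / b)"
      using b by (intro powr_mono2) auto
    then show ?thesis using b that by (simp add: powr_powr exp_powr_real)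
  qed
  have "(\<Prod>i<N. 1 + r / p i) \<le> (\<Prod>i<N. exp ((r / p i) powr b / b))"
    using p r by (intro prod_mono conjI one) (auto simp: add_nonneg_nonneg less_imp_le)
  also have "\<dots> = exp (\<Sum>i<N. (r / p i) powr b / b)" by (simp add: exp_sum)
  also have "(\<Sum>i<N. (r / p i) powr b / b) = (\<Sum>i<N. p i powr - b) * (r powr b / b)"
    unfolding sum_distrib_right using p r
    by (intro sum.cong) (auto simp: powr_divide powr_minus_divide less_imp_le)
  also have "\<dots> \<le> (\<Sum>i. p i powr - b) * (r powr b / b)"
    using b by (intro mult_right_mono sum_le_suminf[OF sm]) auto
  also have "\<dots> = (\<Sum>i. p i powr - b) / b * r powr b" by simp
  finally show ?thesis by simp
qed

text \<open>The zeros are moved to the positive axis, which only decreases the modulus there; bounded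
  growth of the minimum modulus would make the resulting product bounded on that axis.\<close>

lemma minimum_modulus_superlinear:
  assumes h: "transcendental_of_growth s h" and s: "0 < s" "s < 1/2"
  shows "\<exists>r>r0. \<forall>z. norm z = r \<longrightarrow> norm (h z) > C * r"
proof (rule ccontr)
  assume "\<not> (\<exists>r>r0. \<forall>z. norm z = r \<longrightarrow> norm (h z) > C * r)"
  then have small: "\<exists>z. norm z = r \<and> norm (h z) \<le> C * r" if "r > r0" for r
    using that by (meson not_le)
  have s1: "s < 1" using s by simp
  obtain a where a0: "\<And>n::nat. a n \<noteq> 0" and summ: "\<And>b. b > s \<Longrightarrow> summable (\<lambda>n. norm (a n) powr - b)"
    and lim: "\<And>z. (\<lambda>n. \<Prod>i<n. 1 - z / a i) \<longlonglongrightarrow> h z"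
    using genus_zero_factorization[OF h s(1) s1] by metis
  define p where "p = (\<lambda>i. norm (a i))"
  have p: "p i > 0" for i using a0 by (simp add: p_def)
  \<comment> \<open>Any exponent strictly between \<open>s\<close> and \<open>1/2\<close> works:
    above \<open>s\<close> the series over the zeros converges, and below \<open>1/2\<close> the
    boundedness principle on the positive axis applies.\<close>
  define b where "b = (s + 1/2) / 2"
  have b: "0 < b" "b < 1/2" "b > s" using s by (auto simp: b_def)
  have smb: "summable (\<lambda>i. p (Suc i) powr - b)"
    using summ[OF b(3)] by (subst summable_Suc_iff) (simp add: p_def)
  have sm1: "summable (\<lambda>i. 1 / p (Suc i))"
  proof -
    have "summable (\<lambda>i. p i powr - 1)" using summ[of 1] s by (simp add: p_def)
    then show ?thesis using p by (subst summable_Suc_iff) (simp add: powr_minus divide_inverse less_imp_le)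
  qed
  \<comment> \<open>The shift to \<open>Suc i\<close> omits the first zero. Its factor grows
    linearly and later cancels the factor \<open>r\<close> in the assumed bound
    \<open>C * r\<close>.\<close>
  define GN where "GN = (\<lambda>N (z::complex). \<Prod>i<N. 1 - z / of_real (p (Suc i)))"
  define G where "G = (\<lambda>z. lim (\<lambda>N. GN N z))"
  have ul: "uniform_limit (cball 0 r) GN G sequentially" for r
  proof -
    have "uniformly_convergent_on (cball 0 r) (\<lambda>N (z::complex). \<Sum>i<N. norm ((1 - z / of_real (p (Suc i))) - 1))"
    proof (rule Weierstrass_m_test'_ev)
      show "\<forall>\<^sub>F n in sequentially. \<forall>x\<in>cball (0::complex) r. norm (norm ((1 - x / of_real (p (Suc n))) - 1)) \<le> r * (1 / p (Suc n))"
        using p by (intro always_eventually) (auto simp: norm_divide divide_right_mono less_imp_le)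
    qed (intro summable_mult sm1)
    then have "uniformly_convergent_on (cball 0 r) GN"
      unfolding GN_def using p
      by (intro uniformly_convergent_on_prod') (auto intro!: continuous_intros simp: less_imp_neq[symmetric])
    then show ?thesis by (simp add: uniformly_convergent_uniform_limit_iff G_def)
  qed
  have lG: "(\<lambda>N. GN N z) \<longlonglongrightarrow> G z" for z
    by (rule tendsto_uniform_limitI[OF ul[of "norm z"]]) auto
  have Ghol: "G holomorphic_on UNIV"
  proof (rule holomorphic_uniform_sequence)
    show "GN n holomorphic_on UNIV" for n
      unfolding GN_def using p by (intro holomorphic_intros) (auto simp: less_imp_neq[symmetric])
    show "\<exists>d>0. cball x d \<subseteq> UNIV \<and> uniform_limit (cball x d) GN G sequentially" for x
    proof -
      have "cball x 1 \<subseteq> cball 0 (norm x + 1)"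
      proof
        fix y assume "y \<in> cball x 1"
        then show "y \<in> cball 0 (norm x + 1)"
          using norm_triangle_sub[of y x] by (simp add: dist_norm norm_minus_commute)
      qed
      then show ?thesis by (intro exI[of _ 1] conjI uniform_limit_on_subset[OF ul]) auto
    qed
  qed auto
  have grow: "norm (G z) \<le> exp ((\<Sum>i. p (Suc i) powr - b) / b * norm z powr b)" for z
  proof (rule LIMSEQ_le_const2[OF tendsto_norm[OF lG[of z]]], intro exI allI impI)
    fix N
    have "norm (GN N z) \<le> (\<Prod>i<N. 1 + norm z / p (Suc i))"
      unfolding GN_def prod_norm[symmetric]
    proof (intro prod_mono conjI)
      fix i
      have "norm (1 - z / of_real (p (Suc i))) \<le> norm (1::complex) + norm (z / of_real (p (Suc i)))"
        by (rule norm_triangle_ineq4)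
      then show "norm (1 - z / of_real (p (Suc i))) \<le> 1 + norm z / p (Suc i)"
        using p[of "Suc i"] by (simp add: norm_divide)
    qed auto
    also have "\<dots> \<le> exp ((\<Sum>i. p (Suc i) powr - b) / b * norm z powr b)"
      using b p by (intro prod_one_plus_le_exp_powr smb) auto
    finally show "norm (GN N z) \<le> \<dots>" .
  qed
  \<comment> \<open>By the reverse triangle inequality, moving a zero to the positive axis and
    \<open>z\<close> to \<open>norm z\<close> can only decrease the modulus of each factor. The
    omitted first factor is restored on both sides.\<close>
  have cmp: "\<bar>1 - norm z / p 0\<bar> * norm (G (of_real (norm z))) \<le> norm (h z)" for z
  proof (rule LIMSEQ_le)
    show "(\<lambda>N. \<bar>1 - norm z / p 0\<bar> * norm (GN N (of_real (norm z)))) \<longlonglongrightarrow> \<bar>1 - norm z / p 0\<bar> * norm (G (of_real (norm z)))"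
      by (intro tendsto_intros lG)
    show "(\<lambda>N. norm (\<Prod>i<Suc N. 1 - z / a i)) \<longlonglongrightarrow> norm (h z)"
      by (intro tendsto_norm LIMSEQ_Suc[OF lim])
    have one: "\<bar>1 - norm z / p i\<bar> \<le> norm (1 - z / a i)" for i
      using norm_triangle_ineq3[of 1 "z / a i"] by (simp add: norm_divide p_def)
    have "\<bar>1 - norm z / p 0\<bar> * norm (GN N (of_real (norm z))) \<le> norm (\<Prod>i<Suc N. 1 - z / a i)" for N
    proof -
      have e: "norm (1 - complex_of_real (norm z) / of_real (p i)) = \<bar>1 - norm z / p i\<bar>" for i
        by (metis norm_of_real of_real_1 of_real_diff of_real_divide)
      have "\<bar>1 - norm z / p 0\<bar> * norm (GN N (of_real (norm z))) = (\<Prod>i<Suc N. \<bar>1 - norm z / p i\<bar>)"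
        unfolding prod.lessThan_Suc_shift GN_def prod_norm[symmetric] e by simp
      also have "\<dots> \<le> (\<Prod>i<Suc N. norm (1 - z / a i))" using one by (intro prod_mono) auto
      finally show ?thesis by (simp only: prod_norm)
    qed
    then show "\<exists>N. \<forall>n\<ge>N. \<bar>1 - norm z / p 0\<bar> * norm (GN n (of_real (norm z))) \<le> norm (\<Prod>i<Suc n. 1 - z / a i)"
      by blast
  qed
  \<comment> \<open>Beyond \<open>2 * p 0\<close> the first factor has modulus at least
    \<open>x / (2 * p 0)\<close>, and beyond \<open>r0\<close> the negated claim supplies a point
    where \<open>h\<close> is small.\<close>
  define X where "X = max (2 * p 0) (\<bar>r0\<bar> + 1)"
  have "compact (G ` cball 0 X)"
    by (intro compact_continuous_image holomorphic_on_imp_continuous_on holomorphic_on_subset[OF Ghol]) auto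
  then obtain B where B: "B > 0" "\<And>z. norm z \<le> X \<Longrightarrow> norm (G z) \<le> B"
    using compact_imp_bounded bounded_pos by (metis (no_types, lifting) imageI mem_cball_0)
  have real: "norm (G (of_real x)) \<le> max B (2 * p 0 * C)" if "x \<ge> 0" for x
  proof (cases "x \<le> X")
    case True
    then show ?thesis using B(2)[of "of_real x"] that by simp
  next
    case False
    then have x: "x > r0" "x \<ge> 2 * p 0" "x > 0" by (auto simp: X_def)
    obtain z where z: "norm z = x" "norm (h z) \<le> C * x" using small[OF x(1)] by blast
    have "x / (2 * p 0) \<le> \<bar>1 - x / p 0\<bar>" using x p[of 0] by (simp add: field_simps abs_if)
    then have "x / (2 * p 0) * norm (G (of_real x)) \<le> \<bar>1 - x / p 0\<bar> * norm (G (of_real x))"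
      by (rule mult_right_mono) simp
    also have "\<dots> \<le> C * x" using cmp[of z] z by simp
    finally have "norm (G (of_real x)) \<le> 2 * p 0 * C" using x p[of 0] by (simp add: field_simps)
    then show ?thesis by simp
  qed
  have "G constant_on UNIV"
    by (rule entire_bounded_on_positive_reals_constant[OF Ghol real grow]) (use b in auto)
  \<comment> \<open>The contradiction: \<open>G\<close> is 1 at the origin but vanishes at
    \<open>p 1\<close>, the first zero it retains.\<close>
  then have "G 0 = G (of_real (p 1))" by (metis constant_on_def UNIV_I)
  moreover have "G 0 = 1"
    using LIMSEQ_unique[OF lG[of 0], of 1] by (simp add: GN_def)
  moreover have "G (of_real (p 1)) = 0"
  proof (rule LIMSEQ_unique[OF lG])
    have "GN (Suc N) (of_real (p 1)) = 0" for N
      unfolding GN_def prod.lessThan_Suc_shift using p[of 1] by simp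
    then show "(\<lambda>N. GN N (of_real (p 1))) \<longlonglongrightarrow> 0"
      by (subst filterlim_sequentially_Suc[symmetric]) simp
  qed
  ultimately show False by simp
qed

section \<open>Order of growth\<close>

lemma norm_le_max_modulus:
  assumes "f holomorphic_on UNIV"
  shows "norm (f z) \<le> max_modulus f (norm z)"
proof -
  have "continuous_on (sphere 0 (norm z)) (\<lambda>z. norm (f z))"
    by (intro continuous_intros holomorphic_on_imp_continuous_on holomorphic_on_subset[OF assms]) auto
  then have "compact ((\<lambda>z. norm (f z)) ` sphere 0 (norm z))"
    by (intro compact_continuous_image) auto
  then have "bdd_above ((\<lambda>z. norm (f z)) ` sphere 0 (norm z))"
    by (intro bounded_imp_bdd_above compact_imp_bounded)
  then show ?thesis unfolding max_modulus_def by (intro cSUP_upper) auto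
qed

lemma max_modulus_le:
  assumes "r \<ge> 0" "\<And>z. norm z = r \<Longrightarrow> norm (f z) \<le> B"
  shows "max_modulus f r \<le> B"
proof -
  have "complex_of_real r \<in> sphere 0 r" using assms by simp
  then have "sphere (0::complex) r \<noteq> {}" by blast
  then show ?thesis unfolding max_modulus_def using assms by (intro cSUP_least) auto
qed

lemma norm_le_max_modulus_disc:
  assumes hol: "f holomorphic_on UNIV" and "norm z \<le> r" "r > 0"
  shows "norm (f z) \<le> max_modulus f r"
proof (rule maximum_modulus_frontier[of f "cball 0 r"])
  show "norm (f w) \<le> max_modulus f r" if "w \<in> frontier (cball 0 r)" for w
    using norm_le_max_modulus[OF hol, of w] that assms by (simp add: frontier_cball)
qed (use assms in \<open>auto intro!: holomorphic_on_imp_continuous_on holomorphic_on_subset[OF hol]\<close>)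

lemma entire_order_less_imp_bound:
  assumes hol: "f holomorphic_on UNIV" and ord: "entire_order f < ereal s"
  obtains r0 where "\<And>z. norm z \<ge> r0 \<Longrightarrow> norm (f z) \<le> exp (norm z powr s)"
proof -
  have "\<forall>\<^sub>F r in at_top. ereal (ln (ln (max_modulus f r)) / ln r) < ereal s"
    using ord unfolding entire_order_def by (rule Limsup_lessD)
  then have "\<forall>\<^sub>F r in at_top. ln (ln (max_modulus f r)) / ln r < s \<and> r > 1"
    by (auto intro!: eventually_conj eventually_gt_at_top)
  then obtain r0 where r0: "\<And>r. r \<ge> r0 \<Longrightarrow> ln (ln (max_modulus f r)) / ln r < s \<and> r > 1"
    by (auto simp: eventually_at_top_linorder)
  have "norm (f z) \<le> exp (norm z powr s)" if "norm z \<ge> r0" for z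
  \<comment> \<open>If the maximum modulus is at most 1, the iterated logarithm carries no
    information, but the bound is then trivial.\<close>
  proof (cases "max_modulus f (norm z) \<le> 1")
    case True
    then have "norm (f z) \<le> 1" using norm_le_max_modulus[OF hol, of z] by linarith
    also have "1 \<le> exp (norm z powr s)" by simp
    finally show ?thesis .
  next
    case False
    let ?M = "max_modulus f (norm z)" and ?r = "norm z"
    have r: "ln (ln ?M) / ln ?r < s" "?r > 1" using r0[OF that] by auto
    then have "ln (ln ?M) < s * ln ?r"
      using pos_divide_less_eq[OF ln_gt_zero[OF r(2)]] by blast
    moreover have "ln ?M > 0" using False by simp
    ultimately have "ln ?M < exp (s * ln ?r)" by (metis exp_less_cancel_iff exp_ln)
    also have "\<dots> = ?r powr s" using r by (auto simp: powr_def)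
    finally have "exp (ln ?M) < exp (?r powr s)" by simp
    then show ?thesis using norm_le_max_modulus[OF hol, of z] False by simp
  qed
  then show ?thesis using that by blast
qed

text \<open>Its contrapositive turns positive order into the non-polynomial clause of
  \<open>transcendental_of_growth\<close>. Constants are treated apart: whatever real number the
  iterated logarithm denotes for them, dividing it by \<open>ln r\<close> gives limit 0.\<close>

lemma entire_order_polynomial_growth:
  assumes hol: "f holomorphic_on UNIV" and bd: "\<And>z. norm (f z) \<le> C * (1 + norm z) ^ d"
  shows "entire_order f \<le> 0"
proof (cases "f constant_on UNIV")
  case True
  then obtain c where c: "\<And>z. f z = c" by (auto simp: constant_on_def)
  have mm: "max_modulus f r = norm c" if "r > 0" for r
    using max_modulus_le[of r f "norm c"] norm_le_max_modulus[OF hol, of "of_real r"] that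
    by (simp add: c)
  have "((\<lambda>r::real. ln (ln (norm c)) / ln r) \<longlongrightarrow> 0) at_top" by real_asymp
  moreover have "\<forall>\<^sub>F r in at_top. ln (ln (norm c)) / ln r = ln (ln (max_modulus f r)) / ln r"
    using eventually_gt_at_top[of 0] by eventually_elim (simp add: mm)
  ultimately have "((\<lambda>r. ln (ln (max_modulus f r)) / ln r) \<longlongrightarrow> 0) at_top"
    by (simp add: tendsto_cong)
  then have "((\<lambda>r. ereal (ln (ln (max_modulus f r)) / ln r)) \<longlongrightarrow> ereal 0) at_top"
    by (intro tendsto_ereal)
  then show ?thesis unfolding entire_order_def by (subst lim_imp_Limsup) (auto simp: zero_ereal_def)
next
  case False
  define C' where "C' = max C 3"
  define d' where "d' = real (Suc d)"
  \<comment> \<open>Liouville's theorem provides a value of modulus above \<open>exp 1\<close>, so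
    for large \<open>r\<close> the inner logarithm exceeds 1 and the outer one is monotone
    there.\<close>
  obtain z0 where z0: "norm (f z0) > exp 1"
  proof (rule ccontr)
    assume "\<not> thesis"
    then have "bounded (range f)" using that by (force simp: bounded_iff not_le[symmetric])
    then show False using Liouville_theorem[OF hol] False by blast
  qed
  have "\<forall>\<^sub>F r in at_top. ereal (ln (ln (max_modulus f r)) / ln r)
          \<le> ereal (ln (ln C' + d' * ln (1 + r)) / ln r)"
    using eventually_gt_at_top[of "norm z0 + 1"]
  proof eventually_elim
    case (elim r)
    then have r: "r > 1" "r > norm z0" using norm_ge_zero[of z0] by linarith+
    have M: "max_modulus f r > exp 1"
      using norm_le_max_modulus_disc[OF hol, of z0 r] z0 r by simp
    then have M0: "max_modulus f r > 0" by (meson exp_gt_zero less_trans)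
    have lM: "ln (max_modulus f r) > 1" using M M0 by (metis exp_less_cancel_iff exp_ln)
    have "max_modulus f r \<le> C * (1 + r) ^ d"
      by (rule max_modulus_le) (use r bd in auto)
    also have "\<dots> \<le> C' * (1 + r) ^ Suc d"
      using r by (intro mult_mono power_increasing) (auto simp: C'_def)
    finally have "ln (max_modulus f r) \<le> ln (C' * (1 + r) ^ Suc d)" using M0 by simp
    also have "\<dots> = ln C' + d' * ln (1 + r)"
      using r by (subst ln_mult) (auto simp: C'_def d'_def ln_realpow simp del: power_Suc)
    finally have "ln (ln (max_modulus f r)) \<le> ln (ln C' + d' * ln (1 + r))" using lM by simp
    then show ?case using r by (simp add: divide_right_mono)
  qed
  then have "entire_order f \<le> Limsup at_top (\<lambda>r::real. ereal (ln (ln C' + d' * ln (1 + r)) / ln r))"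
    unfolding entire_order_def by (rule Limsup_mono)
  also have "\<dots> = ereal 0"
  proof (rule lim_imp_Limsup)
    have "d' > 0" by (simp add: d'_def)
    then have "((\<lambda>r::real. ln (ln C' + d' * ln (1 + r)) / ln r) \<longlongrightarrow> 0) at_top" by real_asymp
    then show "((\<lambda>r::real. ereal (ln (ln C' + d' * ln (1 + r)) / ln r)) \<longlongrightarrow> ereal 0) at_top"
      by (intro tendsto_ereal)
  qed simp
  finally show ?thesis by (simp add: zero_ereal_def)
qed

text \<open>The normalization to value 1 at the origin changes the modulus by at most
  \<open>c\<close>. The upper bound on the order gives the growth clause, and positivity of the
  order excludes polynomial growth.\<close>

lemma entire_order_imp_transcendental_of_growth:
  assumes hol: "f holomorphic_on UNIV" and pos: "entire_order f > 0" and less: "entire_order f < ereal s"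
  shows "transcendental_of_growth s (\<lambda>z. f z - f 0 + 1)"
proof -
  define c where "c = norm (1 - f 0)"
  have ab: "norm (f z - f 0 + 1) \<le> norm (f z) + c" "norm (f z) \<le> norm (f z - f 0 + 1) + c" for z
    using norm_triangle_ineq[of "f z" "1 - f 0"] norm_triangle_ineq4[of "f z - f 0 + 1" "1 - f 0"]
    by (auto simp: c_def algebra_simps)
  obtain r0 where r0: "\<And>z. norm z \<ge> r0 \<Longrightarrow> norm (f z) \<le> exp (norm z powr s)"
    using entire_order_less_imp_bound[OF hol less] by blast
  have "compact (f ` cball 0 r0)"
    by (intro compact_continuous_image holomorphic_on_imp_continuous_on holomorphic_on_subset[OF hol]) auto
  then obtain B where B: "B > 0" "\<And>z. norm z \<le> r0 \<Longrightarrow> norm (f z) \<le> B"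
    using compact_imp_bounded bounded_pos by (metis (no_types, lifting) imageI mem_cball_0)
  have fb: "norm (f z) \<le> (1 + B) * exp (norm z powr s)" for z
  proof (cases "norm z \<le> r0")
    case True
    have "norm (f z) \<le> (1 + B) * 1" using B(2)[OF True] by simp
    also have "\<dots> \<le> (1 + B) * exp (norm z powr s)" using B(1) by (intro mult_left_mono) auto
    finally show ?thesis .
  next
    case False
    have "norm (f z) \<le> 1 * exp (norm z powr s)" using r0[of z] False by simp
    also have "\<dots> \<le> (1 + B) * exp (norm z powr s)" using B(1) by (intro mult_right_mono) auto
    finally show ?thesis .
  qed
  have c0: "c \<ge> 0" by (simp add: c_def)
  have gb: "norm (f z - f 0 + 1) \<le> exp (ln (1 + B + c) + norm z powr s)" for z
  proof -
    have "c * 1 \<le> c * exp (norm z powr s)" using c0 by (intro mult_left_mono) auto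
    then have "norm (f z - f 0 + 1) \<le> (1 + B + c) * exp (norm z powr s)"
      using ab(1)[of z] fb[of z] by (simp add: algebra_simps)
    then show ?thesis using B(1) c0 by (simp add: exp_add)
  qed
  have np: "\<exists>z. norm (f z - f 0 + 1) > C * (1 + norm z) ^ d" for C d
  proof (rule ccontr)
    assume "\<nexists>z. norm (f z - f 0 + 1) > C * (1 + norm z) ^ d"
    then have *: "norm (f z - f 0 + 1) \<le> C * (1 + norm z) ^ d" for z by (meson not_le)
    have "norm (f z) \<le> (C + c) * (1 + norm z) ^ d" for z
    proof -
      have "c * 1 \<le> c * (1 + norm z) ^ d" using c0 by (intro mult_left_mono one_le_power) auto
      then show ?thesis using ab(2)[of z] *[of z] by (simp add: algebra_simps)
    qed
    then have "entire_order f \<le> 0" by (rule entire_order_polynomial_growth[OF hol])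
    then show False using pos by simp
  qed
  have "(\<lambda>z. f z - f 0 + 1) holomorphic_on UNIV" by (intro holomorphic_intros hol)
  then show ?thesis unfolding transcendental_of_growth_def using gb np by auto
qed

section \<open>Sums over preimages\<close>

text \<open>The sum depends on \<open>w\<close> only through \<open>f w\<close>. Taking the value
  \<open>y\<close> as the variable makes the residue integrand rational in \<open>y\<close>;
  holomorphy in \<open>w\<close> follows by composing with \<open>f\<close>.\<close>

definition preimage_sum :: "(complex \<Rightarrow> complex) \<Rightarrow> real \<Rightarrow> complex \<Rightarrow> complex" where
  "preimage_sum f R y = (\<Sum>u\<in>{u. norm u < R \<and> f u = y}. of_int (zorder (\<lambda>v. f v - y) u) * u)"

lemma aut_sum_eq_preimage_sum: "aut_sum f R w = preimage_sum f R (f w)"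
  by (simp add: aut_sum_def preimage_sum_def)

text \<open>The argument principle weighted by \<open>u\<close>: the residue of the integrand at a
  zero of \<open>f u - y\<close> is that zero times its order.\<close>

lemma preimage_sum_contour_integral:
  assumes hol: "f holomorphic_on UNIV" and nc: "\<not> f constant_on UNIV" and R: "R > 0"
    and ny: "\<And>u. norm u = R \<Longrightarrow> f u \<noteq> y"
  shows "contour_integral (circlepath 0 R) (\<lambda>u. deriv f u * u / (f u - y)) = 2 * pi * \<i> * preimage_sum f R y"
proof -
  \<comment> \<open>The domain must contain the closed disc. Zeros between the radii
    \<open>R\<close> and \<open>R + 1\<close> have winding number 0 and drop out of the sum.\<close>
  let ?S = "ball (0::complex) (R + 1)" and ?g = "circlepath 0 R" and ?F = "\<lambda>u. f u - y"
  let ?pz = "{w\<in>?S. ?F w = 0 \<or> w \<in> {}}"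
  have Fhol: "?F holomorphic_on A" for A by (intro holomorphic_intros holomorphic_on_subset[OF hol]) auto
  have "\<not> ?F constant_on UNIV"
    using nc unfolding constant_on_def by (metis diff_add_cancel)
  then have "finite {z\<in>cball 0 (R + 1). ?F z = 0}"
    by (intro holomorphic_compact_finite_zeros[of _ UNIV] Fhol) auto
  then have fin: "finite ?pz" by (rule rev_finite_subset) auto
  have pim: "path_image ?g = sphere 0 R" using R by simp
  have wn0: "winding_number ?g z = 0" if "norm z > R" for z
    by (rule winding_number_zero_outside[of _ "cball 0 R"]) (use that R in auto)
  have "contour_integral ?g (\<lambda>x. deriv ?F x * x / ?F x)
      = 2 * pi * \<i> * (\<Sum>p\<in>?pz. winding_number ?g p * p * zorder ?F p)"
  proof (rule argument_principle[of ?S ?F "{}" "\<lambda>x. x" ?g])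
    show "path_image ?g \<subseteq> ?S - ?pz" unfolding pim using ny R by force
    show "\<forall>z. z \<notin> ?S \<longrightarrow> winding_number ?g z = 0" using wn0 by auto
  qed (use fin Fhol in \<open>auto intro!: holomorphic_intros\<close>)
  also have "(\<Sum>p\<in>?pz. winding_number ?g p * p * zorder ?F p) = preimage_sum f R y"
    unfolding preimage_sum_def
  proof (rule sum.mono_neutral_cong_right[OF fin])
    show "{u. norm u < R \<and> f u = y} \<subseteq> ?pz" by auto
    show "\<forall>i\<in>?pz - {u. norm u < R \<and> f u = y}. winding_number ?g i * i * zorder ?F i = 0"
    proof
      fix i assume "i \<in> ?pz - {u. norm u < R \<and> f u = y}"
      then have "norm i > R" using ny[of i] by force
      then show "winding_number ?g i * i * zorder ?F i = 0" using wn0 by simp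
    qed
  qed (use winding_number_circlepath[of _ 0 R] in auto)
  finally have "contour_integral ?g (\<lambda>x. deriv ?F x * x / ?F x) = 2 * pi * \<i> * preimage_sum f R y" .
  moreover have "deriv ?F x = deriv f x" for x
  proof -
    have "f field_differentiable at x" using hol by (simp add: holomorphic_on_def)
    then show ?thesis by simp
  qed
  ultimately show ?thesis by simp
qed

text \<open>For \<open>y\<close> in the disc of radius \<open>M\<close> the denominator
  \<open>f u - y\<close> does not vanish on the circle, so the integral representation can be
  differentiated under the integral sign.\<close>

lemma preimage_sum_holomorphic:
  assumes hol: "f holomorphic_on UNIV" and nc: "\<not> f constant_on UNIV" and R: "R > 0"
    and ny: "\<And>u. norm u = R \<Longrightarrow> norm (f u) \<ge> M"
  shows "preimage_sum f R holomorphic_on ball 0 M"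
proof -
  let ?g = "circlepath 0 R"
  define g' where "g' = (\<lambda>t::real. 2 * pi * \<i> * R * exp (2 * of_real pi * \<i> * t))"
  define T where "T = (\<lambda>y t. deriv f (?g t) * ?g t / (f (?g t) - y) * g' t)"
  have ng: "norm (?g t) = R" for t using R by (simp add: circlepath norm_mult)
  have nz: "f (?g t) - y \<noteq> 0" if "y \<in> ball 0 M" for y t
    using ny[OF ng[of t]] that by auto
  have fc: "continuous_on A f" and dc: "continuous_on A (deriv f)" for A
    using hol by (auto intro!: holomorphic_on_imp_continuous_on holomorphic_on_subset[OF hol]
        holomorphic_on_subset[OF holomorphic_deriv[OF hol open_UNIV]])
  have gc: "continuous_on A ?g" for A
    unfolding circlepath by (intro continuous_intros)
  have g'c: "continuous_on A g'" for A
    unfolding g'_def by (intro continuous_intros)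
  have "(\<lambda>y. integral (cbox 0 1) (T y)) holomorphic_on ball 0 M"
  proof (rule leibniz_rule_holomorphic)
    show "((\<lambda>y. T y t) has_field_derivative deriv f (?g t) * ?g t / (f (?g t) - y)\<^sup>2 * g' t) (at y within ball 0 M)"
      if "y \<in> ball 0 M" for y t
      unfolding T_def using nz[OF that, of t]
      by (auto intro!: derivative_eq_intros simp: power2_eq_square field_simps)
    show "T y integrable_on cbox 0 1" if "y \<in> ball 0 M" for y
      unfolding T_def using nz[OF that]
      by (intro integrable_continuous continuous_intros g'c gc
          continuous_on_compose2[OF fc[of UNIV] gc] continuous_on_compose2[OF dc[of UNIV] gc]) auto
    show "continuous_on (ball 0 M \<times> cbox 0 1) (\<lambda>(y, t). deriv f (?g t) * ?g t / (f (?g t) - y)\<^sup>2 * g' t)"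
      unfolding case_prod_unfold using nz
      by (intro continuous_intros
          continuous_on_compose2[OF g'c[of UNIV]] continuous_on_compose2[OF gc[of UNIV]]
          continuous_on_compose2[OF fc[of UNIV]] continuous_on_compose2[OF dc[of UNIV]]) auto
  qed simp
  then have "(\<lambda>y. integral (cbox 0 1) (T y) / (2 * pi * \<i>)) holomorphic_on ball 0 M"
    by (intro holomorphic_intros) auto
  moreover have "integral (cbox 0 1) (T y) / (2 * pi * \<i>) = preimage_sum f R y" if "y \<in> ball 0 M" for y
  proof -
    have "f u \<noteq> y" if "norm u = R" for u using ny[OF that] \<open>y \<in> ball 0 M\<close> by auto
    then have "2 * pi * \<i> * preimage_sum f R y = contour_integral ?g (\<lambda>u. deriv f u * u / (f u - y))"
      by (intro preimage_sum_contour_integral[symmetric] hol nc R)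
    also have "\<dots> = integral (cbox 0 1) (T y)"
      unfolding contour_integral_integral vector_derivative_circlepath T_def g'_def by simp
    finally show ?thesis by (simp add: field_simps)
  qed
  ultimately show ?thesis by (rule holomorphic_transform)
qed

text \<open>Integration by parts turns the difference of the two residue integrals into the integral of
  the logarithm of \<open>(f u - y) / (f u - y')\<close>, which is small on the circle.\<close>

lemma preimage_sum_diff_bound:
  assumes hol: "f holomorphic_on UNIV" and nc: "\<not> f constant_on UNIV" and R: "R > 0"
    and M: "M > 0" and m: "m \<ge> 8 * M" and fm: "\<And>u. norm u = R \<Longrightarrow> norm (f u) \<ge> m"
    and y: "norm y \<le> M" and y': "norm y' \<le> M"
  shows "norm (preimage_sum f R y - preimage_sum f R y') \<le> 6 * M / m * R"
proof -
  let ?g = "circlepath 0 R"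
  define Q where "Q = (\<lambda>u. (f u - y) / (f u - y'))"
  have pim: "path_image ?g = sphere 0 R" using R by simp
  have nz: "f u - v \<noteq> 0" if "norm u = R" "norm v \<le> M" for u v
    using fm[OF that(1)] that(2) m M by auto
  \<comment> \<open>Here \<open>m \<ge> 8 * M\<close> leaves at least \<open>m * 7 / 8\<close> for
    the denominator, and \<open>16 / 7\<close> is rounded up to 3. The resulting bound
    \<open>3 / 8\<close> keeps \<open>Q\<close> off the branch cut of \<open>Ln\<close> and within
    the range of the estimate for \<open>Ln (1 + x)\<close>.\<close>
  have small: "norm (Q u - 1) \<le> 3 * M / m" if u: "norm u = R" for u
  proof -
    have "Q u - 1 = (y' - y) / (f u - y')" using nz[OF u y'] by (simp add: Q_def field_simps)
    moreover have "norm (y' - y) \<le> 2 * M" using norm_triangle_ineq4[of y' y] y y' by linarith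
    moreover have "norm (f u - y') \<ge> m * 7 / 8"
      using norm_triangle_ineq2[of "f u" y'] fm[OF u] y' m by linarith
    ultimately have "norm (Q u - 1) \<le> 2 * M / (m * 7 / 8)"
      using m M by (simp only: norm_divide) (intro frac_le, auto)
    also have "\<dots> \<le> 3 * M / m" using m M by (simp add: field_simps)
    finally show ?thesis .
  qed
  have m38: "3 * M / m \<le> 3 / 8" using m M by (simp add: field_simps)
  have Qnp: "Q u \<notin> \<real>\<^sub>\<le>\<^sub>0" if u: "norm u = R" for u
  proof -
    have "\<bar>Re (Q u - 1)\<bar> \<le> 3 / 8" using abs_Re_le_cmod[of "Q u - 1"] small[OF u] m38 by linarith
    then show ?thesis by (auto simp: complex_nonpos_Reals_iff)
  qed
  have df: "(f has_field_derivative deriv f u) (at u)" for u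
    using hol by (simp add: holomorphic_derivI)
  define I where "I = (\<lambda>v u. deriv f u * u / (f u - v))"
  have cI: "I v contour_integrable_on ?g" if "norm v \<le> M" for v
    unfolding I_def
    by (intro contour_integrable_continuous_circlepath continuous_intros
        holomorphic_on_imp_continuous_on holomorphic_on_subset[OF hol]
        holomorphic_on_subset[OF holomorphic_deriv[OF hol open_UNIV]])
       (use nz[OF _ that] R in auto)
  \<comment> \<open>The integrand has the primitive \<open>u * Ln (Q u)\<close>, because
    \<open>u\<close> times the logarithmic derivative of \<open>Q\<close> is
    \<open>I y u - I y' u\<close>. It is single-valued along the closed circle, so the integral is
    0.\<close>
  have "((\<lambda>u. Ln (Q u) + (I y u - I y' u)) has_contour_integral
      pathfinish ?g * Ln (Q (pathfinish ?g)) - pathstart ?g * Ln (Q (pathstart ?g))) ?g"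
  proof (rule contour_integral_primitive[where S = "sphere 0 R"])
    show "((\<lambda>u. u * Ln (Q u)) has_field_derivative Ln (Q u) + (I y u - I y' u)) (at u within sphere 0 R)"
      if "u \<in> sphere 0 R" for u
    proof -
      have u: "norm u = R" using that by simp
      note n = nz[OF u y] nz[OF u y']
      have "(Q has_field_derivative (deriv f u * (f u - y') - (f u - y) * deriv f u) / ((f u - y') * (f u - y'))) (at u)"
        unfolding Q_def using n df[of u] by (auto intro!: derivative_eq_intros)
      then have "((\<lambda>u. u * Ln (Q u)) has_field_derivative
          Ln (Q u) + u * ((deriv f u * (f u - y') - (f u - y) * deriv f u) / ((f u - y') * (f u - y')) / Q u)) (at u)"
        using Qnp[OF u] by (auto intro!: derivative_eq_intros simp: divide_inverse mult_ac)
      moreover have "u * ((deriv f u * (f u - y') - (f u - y) * deriv f u) / ((f u - y') * (f u - y')) / Q u) = I y u - I y' u"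
        using n by (simp add: Q_def I_def divide_simps) (simp add: algebra_simps)
      ultimately show ?thesis by (simp add: has_field_derivative_at_within)
    qed
  qed (use R in auto)
  then have "((\<lambda>u. Ln (Q u) + (I y u - I y' u)) has_contour_integral 0) ?g" by simp
  moreover have "((\<lambda>u. I y u - I y' u) has_contour_integral
      (2 * pi * \<i> * preimage_sum f R y - 2 * pi * \<i> * preimage_sum f R y')) ?g"
  proof -
    have "contour_integral ?g (I v) = 2 * pi * \<i> * preimage_sum f R v" if "norm v \<le> M" for v
      unfolding I_def by (intro preimage_sum_contour_integral hol nc R) (use nz[OF _ that] in auto)
    then show ?thesis
      using has_contour_integral_integral[OF cI] y y' by (metis has_contour_integral_diff)
  qed
  ultimately have "((\<lambda>u. Ln (Q u) + (I y u - I y' u) - (I y u - I y' u)) has_contour_integral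
      0 - (2 * pi * \<i> * preimage_sum f R y - 2 * pi * \<i> * preimage_sum f R y')) ?g"
    by (rule has_contour_integral_diff)
  then have "((\<lambda>u. Ln (Q u)) has_contour_integral
      - (2 * pi * \<i> * (preimage_sum f R y - preimage_sum f R y'))) ?g"
    by (simp add: algebra_simps)
  then have "norm (- (2 * pi * \<i> * (preimage_sum f R y - preimage_sum f R y'))) \<le> 6 * M / m * (2 * pi * R)"
  proof (rule has_contour_integral_bound_circlepath)
    fix u :: complex assume "norm (u - 0) = R"
    then have u: "norm u = R" by simp
    have "norm (Ln (1 + (Q u - 1))) \<le> 2 * norm (Q u - 1)"
      using small[OF u] m38 by (intro norm_Ln_le) linarith
    then show "norm (Ln (Q u)) \<le> 6 * M / m" using small[OF u] by simp
  qed (use M m R in auto)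
  then have "2 * pi * norm (preimage_sum f R y - preimage_sum f R y') \<le> 2 * pi * (6 * M / m * R)"
    by (simp only: norm_minus_cancel norm_mult norm_ii norm_of_real abs_of_pos[OF pi_gt_zero]) (simp add: mult_ac)
  then show ?thesis by (rule mult_left_le_imp_le) simp
qed

section \<open>Choice of the radii and Cauchy estimates\<close>

theorem theorem15:
  fixes f :: "complex \<Rightarrow> complex" and \<rho> :: real
  assumes "f holomorphic_on UNIV"
    and "entire_order f = ereal \<rho>"
    and "0 < \<rho>" and "\<rho> < 1/2"
  shows "\<exists>R :: nat \<Rightarrow> real. (\<forall>j. 0 < R j) \<and> strict_mono R \<and> filterlim R at_top sequentially \<and>
           (\<forall>k::nat. k \<ge> 1 \<longrightarrow> (\<forall>w. ((\<lambda>j. (deriv ^^ k) (aut_sum f (R j)) w) \<longlongrightarrow> 0) sequentially))"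
proof -
  note hol = assms(1)
  define s where "s = (\<rho> + 1/2) / 2"
  have s: "0 < s" "s < 1/2" "\<rho> < s" using assms by (auto simp: s_def)
  define g where "g = (\<lambda>z. f z - f 0 + 1)"
  have g: "transcendental_of_growth s g"
    unfolding g_def by (rule entire_order_imp_transcendental_of_growth[OF hol]) (use assms s in auto)
  have nc: "\<not> f constant_on UNIV"
  proof
    assume "f constant_on UNIV"
    then have "norm (g z) \<le> 1 * (1 + norm z) ^ 0" for z by (auto simp: g_def constant_on_def)
    then show False using g unfolding transcendental_of_growth_def by (meson not_le)
  qed
  \<comment> \<open>The factor \<open>j\<close> makes the minimum modulus outgrow the radius along
    the sequence, and \<open>r > real j\<close> sends the radii to infinity.\<close>
  define P where "P = (\<lambda>(j::nat) r. r > real j \<and> r \<ge> 1 \<and> (\<forall>z. norm z = r \<longrightarrow> norm (f z) \<ge> real j * r))"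
  have ex: "\<exists>r>r0. P j r" for j r0
  proof -
    define c where "c = norm (f 0 - 1)"
    obtain r where r: "r > max r0 (max (real j) 1)" "\<And>z. norm z = r \<Longrightarrow> norm (g z) > (real j + c) * r"
      using minimum_modulus_superlinear[OF g s(1,2), of "max r0 (max (real j) 1)" "real j + c"] by blast
    have "norm (f z) \<ge> real j * r" if "norm z = r" for z
    proof -
      have "norm (g z) \<le> norm (f z) + c"
        using norm_triangle_ineq4[of "f z" "f 0 - 1"] by (simp add: g_def c_def algebra_simps)
      moreover have "c * 1 \<le> c * r" using r(1) by (intro mult_left_mono) (auto simp: c_def)
      ultimately show ?thesis using r(2)[OF that] by (simp add: algebra_simps)
    qed
    then show ?thesis using r(1) by (intro exI[of _ r]) (auto simp: P_def)
  qed
  obtain R where R: "\<And>j. P j (R j)" "\<And>j. R j < R (Suc j)"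
  proof -
    have "\<exists>R. \<forall>j. P j (R j) \<and> R j < R (Suc j)"
      using ex by (intro dependent_nat_choice) blast+
    then show ?thesis using that by blast
  qed
  have R1: "R j > real j" "R j \<ge> 1" and Rf: "\<And>z. norm z = R j \<Longrightarrow> norm (f z) \<ge> real j * R j" for j
    using R(1)[of j] by (auto simp: P_def)
  have "(\<lambda>j. (deriv ^^ k) (aut_sum f (R j)) w) \<longlonglongrightarrow> 0" if k: "k \<ge> 1" for k w
  proof -
    \<comment> \<open>The disc contains both the closed unit disc around \<open>w\<close>, for
      Cauchy's estimate, and the origin, whose value is the reference for the differences.\<close>
    define D where "D = ball (0::complex) (norm w + 2)"
    have sub: "cball w 1 \<subseteq> D"
    proof
      fix x assume "x \<in> cball w 1"
      then show "x \<in> D" using norm_triangle_sub[of x w] by (simp add: D_def dist_norm norm_minus_commute)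
    qed
    have "compact (f ` cball 0 (norm w + 2))"
      by (intro compact_continuous_image holomorphic_on_imp_continuous_on holomorphic_on_subset[OF hol]) auto
    then obtain M0 where M0: "M0 > 0" "\<And>z. norm z \<le> norm w + 2 \<Longrightarrow> norm (f z) \<le> M0"
      using compact_imp_bounded bounded_pos by (metis (no_types, lifting) imageI mem_cball_0)
    define M where "M = M0 + 1"
    have M: "M > 0" "\<And>z. z \<in> D \<Longrightarrow> norm (f z) < M" 
      using M0(1) by (simp_all add: M_def D_def less_imp_le le_less_trans[OF M0(2)])
    have ev: "norm ((deriv ^^ k) (aut_sum f (R j)) w) \<le> fact k * (7 * M / real j)" if j: "real j \<ge> 8 * M" for j
    proof -
      have j0: "real j > 0" using j M by linarith
      have mM: "real j * R j \<ge> 8 * M" using mult_mono[of "8 * M" "real j" 1 "R j"] j R1[of j] M by simp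
      have Rp: "R j > 0" using R1[of j] by linarith
      have "preimage_sum f (R j) holomorphic_on ball 0 M"
        by (rule preimage_sum_holomorphic[OF hol nc Rp]) (use Rf mM M in \<open>force intro: order_trans\<close>)
      then have "(preimage_sum f (R j) \<circ> f) holomorphic_on D"
        by (intro holomorphic_on_compose_gen[OF holomorphic_on_subset[OF hol]]) (use M in auto)
      moreover have "aut_sum f (R j) = preimage_sum f (R j) \<circ> f"
        by (auto simp: aut_sum_eq_preimage_sum)
      ultimately have ah: "aut_sum f (R j) holomorphic_on D" by simp
      \<comment> \<open>Since \<open>k \<ge> 1\<close>, only the distance of the sum from a constant
        matters, here its value at 0. In the difference bound the radius cancels against the minimum
        modulus; 7 instead of 6 gives the strict inequality for the open ball.\<close>
      have "norm ((deriv ^^ k) (aut_sum f (R j)) w) \<le> fact k * (7 * M / real j) / 1 ^ k"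
      proof (rule Cauchy_higher_deriv_bound)
        show "aut_sum f (R j) holomorphic_on ball w 1"
          using ball_subset_cball sub by (intro holomorphic_on_subset[OF ah]) blast
        show "continuous_on (cball w 1) (aut_sum f (R j))"
          using sub by (intro holomorphic_on_imp_continuous_on holomorphic_on_subset[OF ah])
        show "aut_sum f (R j) x \<in> ball (aut_sum f (R j) 0) (7 * M / real j)" if "x \<in> ball w 1" for x
        proof -
          have "x \<in> D" using that sub ball_subset_cball by blast
          moreover have "0 \<in> D" by (simp add: D_def add_nonneg_pos)
          ultimately have "norm (aut_sum f (R j) 0 - aut_sum f (R j) x) \<le> 6 * M / (real j * R j) * R j"
            unfolding aut_sum_eq_preimage_sum
            by (intro preimage_sum_diff_bound hol nc Rp M mM Rf less_imp_le[OF M(2)])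
          also have "\<dots> = 6 * M / real j" using Rp by simp
          also have "\<dots> < 7 * M / real j" using M j0 by (intro divide_strict_right_mono) auto
          finally show ?thesis by (simp add: dist_norm)
        qed
      qed (use k in auto)
      then show ?thesis by simp
    qed
    have "\<forall>\<^sub>F j in sequentially. norm ((deriv ^^ k) (aut_sum f (R j)) w) \<le> fact k * (7 * M / real j)"
      using eventually_ge_at_top[of "nat \<lceil>8 * M\<rceil>"] by eventually_elim (rule ev, linarith)
    moreover have "(\<lambda>j. fact k * (7 * M / real j)) \<longlonglongrightarrow> fact k * 0"
      by (intro tendsto_mult_left lim_const_over_n)
    then have "(\<lambda>j. fact k * (7 * M / real j)) \<longlonglongrightarrow> 0" by simp
    ultimately show ?thesis by (rule Lim_null_comparison)
  qed
  moreover have "filterlim R at_top sequentially"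
    by (rule filterlim_at_top_mono[OF filterlim_real_sequentially])
       (use R1 in \<open>auto intro!: always_eventually less_imp_le\<close>)
  moreover have "0 < R j" for j using R1(2)[of j] by linarith
  moreover have "strict_mono R" using R(2) by (simp add: strict_mono_Suc_iff)
  ultimately show ?thesis by blast
qed

end
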